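(* Let $f$ be a nonconstant meromorphic function on $\mathbb{C}$ which omits a finite value, i.e. there is $w\in\mathbb{C}$ with $f(z)\neq w$ for all $z\in\mathbb{C}$. Then $S_f=S_{1/f}$ as meromorphic functions on $\mathbb{C}$.
   Context: For a nonconstant meromorphic function $f$ on $\mathbb{C}$, the Schwarzian derivative is the meromorphic function $S_f(z)=\frac{f'''(z)}{f'(z)}-\frac{3}{2}\left(\frac{f''(z)}{f'(z)}\right)^2$. *)

theory Defs
  imports "HOL-Complex_Analysis.Complex_Analysis"
begin

(* A meromorphic function on the plane is represented by its canonical total representative
   (nicely_meromorphic_on): continuous off the poles, and 0 at the poles. The pointwise
   Schwarzian formula takes arbitrary values at the poles of f and at the zeros of f', so
   remove_sings is applied to it; equality of two functions of this form is
   equality of meromorphic functions, poles included. *)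

definition schwarzian :: "(complex \<Rightarrow> complex) \<Rightarrow> complex \<Rightarrow> complex" where
  "schwarzian f = remove_sings (\<lambda>z.
     (deriv ^^ 3) f z / deriv f z - 3 / 2 * ((deriv ^^ 2) f z / deriv f z)\<^sup>2)"

lemma nicely_meromorphic_on_schwarzian:
  assumes "f meromorphic_on A"
  shows "schwarzian f nicely_meromorphic_on A"
  unfolding schwarzian_def
  by (intro remove_sings_nicely_meromorphic meromorphic_intros assms)

end

(* Write g = 1 / f. On an open set where f is holomorphic without zeros, differentiating
   g' = - f' / f^2 twice more gives g'' / g' = f'' / f' - 2 f' / f and
   g''' / g' = f''' / f' - 6 f'' / f + 6 f'^2 / f^2, so the terms involving f itself cancel
   in the Schwarzian of g. The points left out are isolated, and remove_sings
   depends only on the values at nearby points. *)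

theory Submission
  imports Defs
begin

text \<open>The raw formula before \<open>remove_sings\<close>, kept separate so that values can be
  compared point by point.\<close>

definition pointwise_schwarzian :: "(complex \<Rightarrow> complex) \<Rightarrow> complex \<Rightarrow> complex" where
  "pointwise_schwarzian f z =
     (deriv ^^ 3) f z / deriv f z - 3 / 2 * ((deriv ^^ 2) f z / deriv f z)\<^sup>2"

lemma schwarzian_altdef: "schwarzian f = remove_sings (pointwise_schwarzian f)"
  by (simp add: schwarzian_def pointwise_schwarzian_def [abs_def])

lemma pointwise_schwarzian_cong:
  assumes "eventually (\<lambda>w. f w = g w) (nhds z)"
  shows "pointwise_schwarzian f z = pointwise_schwarzian g z"
  using higher_deriv_cong_ev [OF assms refl] deriv_cong_ev [OF assms refl]
  by (simp add: pointwise_schwarzian_def)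

lemma pointwise_schwarzian_reciprocal:
  assumes "f analytic_on {z}" "f z \<noteq> 0"
  shows "pointwise_schwarzian (\<lambda>w. 1 / f w) z = pointwise_schwarzian f z"
proof -
  obtain S where S: "open S" "z \<in> S" "f holomorphic_on S"
    using assms(1) by (auto simp: analytic_at)
  \<comment> \<open>The formulas for the derivatives of \<open>1 / f\<close> get differentiated
    again, so they must hold on a whole open set around \<open>z\<close>; this is why the zeros of
    \<open>f\<close> are cut out of \<open>S\<close>.\<close>
  define U where "U = S \<inter> f -` (- {0})"
  have U: "open U" "f holomorphic_on U" "z \<in> U"
    using S assms(2) continuous_open_preimage [OF holomorphic_on_imp_continuous_on [OF S(3)]]
    by (auto simp: U_def intro: holomorphic_on_subset)
  have ev: "eventually (\<lambda>w. w \<in> U) (nhds z)"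
    using U by (simp add: eventually_nhds_in_open)
  have df: "((deriv ^^ n) f has_field_derivative (deriv ^^ Suc n) f w) (at w)"
    if "w \<in> U" for w n
    using holomorphic_derivI [OF holomorphic_higher_deriv [OF U(2,1)] U(1) that] by simp
  have df0: "(f has_field_derivative deriv f w) (at w)" if "w \<in> U" for w
    using df [OF that, of 0] by simp
  have df1: "(deriv f has_field_derivative (deriv ^^ 2) f w) (at w)" if "w \<in> U" for w
    using df [OF that, of 1] by (simp add: numeral_2_eq_2)
  have df2: "((deriv ^^ 2) f has_field_derivative (deriv ^^ 3) f w) (at w)" if "w \<in> U" for w
    using df [OF that, of 2] by (simp add: numeral_3_eq_3 numeral_2_eq_2)
  let ?g = "\<lambda>w. 1 / f w"
  let ?g1 = "\<lambda>w. - deriv f w / f w ^ 2"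
  let ?g2 = "\<lambda>w. - (deriv ^^ 2) f w / f w ^ 2 + 2 * deriv f w ^ 2 / f w ^ 3"
  let ?g3 = "\<lambda>w. - (deriv ^^ 3) f w / f w ^ 2 + 6 * deriv f w * (deriv ^^ 2) f w / f w ^ 3
                 - 6 * deriv f w ^ 3 / f w ^ 4"
  have nz: "f w \<noteq> 0" if "w \<in> U" for w
    using that by (simp add: U_def)
  have g1: "deriv ?g w = ?g1 w" if "w \<in> U" for w
    using nz [OF that]
    by (intro DERIV_imp_deriv)
       (auto intro!: derivative_eq_intros df0 that simp: power2_eq_square)
  \<comment> \<open>\<open>g2\<close> and \<open>g3\<close> differentiate the closed forms only;
    \<open>e1\<close>, \<open>e2\<close> and \<open>e3\<close> below transfer them to the iterated
    derivatives of \<open>1 / f\<close>.\<close>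
  have g2: "deriv ?g1 w = ?g2 w" if "w \<in> U" for w
    using nz [OF that]
    by (intro DERIV_imp_deriv)
       (auto intro!: derivative_eq_intros df0 df1 that
             simp: field_simps eval_nat_numeral)
  have g3: "deriv ?g2 w = ?g3 w" if "w \<in> U" for w
    using nz [OF that]
    by (intro DERIV_imp_deriv)
       (rule derivative_eq_intros df0 df1 df2 that refl | simp add: field_simps eval_nat_numeral)+
  have e1: "eventually (\<lambda>w. deriv ?g w = ?g1 w) (nhds z)"
    using ev by eventually_elim (rule g1)
  have e2: "eventually (\<lambda>w. (deriv ^^ 2) ?g w = ?g2 w) (nhds z)"
  proof -
    \<comment> \<open>To differentiate \<open>e1\<close> at a point \<open>w\<close> near
      \<open>z\<close>, it must hold in a neighbourhood of \<open>w\<close>, not only of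
      \<open>z\<close>.\<close>
    have "eventually (\<lambda>w. eventually (\<lambda>u. deriv ?g u = ?g1 u) (nhds w)) (nhds z)"
      using e1 by (subst eventually_eventually)
    then show ?thesis
      using ev
    proof eventually_elim
      case (elim w)
      have "(deriv ^^ 2) ?g w = deriv (deriv ?g) w"
        by (simp add: numeral_2_eq_2)
      also have "\<dots> = ?g2 w"
        using deriv_cong_ev [OF elim(1) refl] g2 [OF elim(2)] by (rule trans)
      finally show ?case .
    qed
  qed
  have "(deriv ^^ 3) ?g z = deriv ((deriv ^^ 2) ?g) z"
    by (simp add: numeral_3_eq_3 numeral_2_eq_2)
  also have "\<dots> = ?g3 z"
    using deriv_cong_ev [OF e2 refl] g3 [OF U(3)] by (rule trans)
  finally have e3: "(deriv ^^ 3) ?g z = ?g3 z" .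
  \<comment> \<open>Here \<open>y\<close>, \<open>a\<close>, \<open>b\<close>, \<open>c\<close>
    stand for \<open>f\<close> and its first three derivatives at \<open>z\<close>. Expanding the
    square of \<open>b / a - 2 * a / y\<close> yields the terms that cancel
    \<open>- 6 * b / y + 6 * a ^ 2 / y ^ 2\<close>.\<close>
  have identity: "(- c / y ^ 2 + 6 * a * b / y ^ 3 - 6 * a ^ 3 / y ^ 4) / (- a / y ^ 2)
      - 3 / 2 * ((- b / y ^ 2 + 2 * a ^ 2 / y ^ 3) / (- a / y ^ 2)) ^ 2
      = c / a - 3 / 2 * (b / a) ^ 2" if "y \<noteq> 0" for a b c y :: complex
  proof (cases "a = 0")
    case False
    have 1: "(- c / y ^ 2 + 6 * a * b / y ^ 3 - 6 * a ^ 3 / y ^ 4) / (- a / y ^ 2)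
        = c / a - 6 * b / y + 6 * a ^ 2 / y ^ 2"
      using False that by (simp add: field_simps eval_nat_numeral)
    have 2: "(- b / y ^ 2 + 2 * a ^ 2 / y ^ 3) / (- a / y ^ 2) = b / a - 2 * a / y"
      using False that by (simp add: field_simps eval_nat_numeral)
    show ?thesis
      unfolding 1 2 using False that by (simp add: field_simps power2_eq_square)
  qed simp \<comment> \<open>for \<open>a = 0\<close>, both sides are 0 because of division by zero\<close>
  show ?thesis
    unfolding pointwise_schwarzian_def e3 eventually_nhds_x_imp_x [OF e1]
      eventually_nhds_x_imp_x [OF e2]
    using assms(2) by (rule identity)
qed

text \<open>At each \<open>z\<close> it suffices that the raw formulas agree on a punctured
  neighbourhood. There a meromorphic \<open>f\<close> is either identically zero or free of
  zeros.\<close>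

lemma schwarzian_reciprocal:
  assumes "f meromorphic_on UNIV"
  shows "schwarzian (\<lambda>z. 1 / f z) = schwarzian f"
  unfolding schwarzian_altdef
proof
  fix z
  have mero: "f meromorphic_on {z}"
    using assms by (rule meromorphic_on_subset) simp
  consider "eventually (\<lambda>w. f w = 0) (at z)" | "eventually (\<lambda>w. f w \<noteq> 0) (at z)"
    using mero non_zero_neighbour [of f z]
    by (auto simp: meromorphic_at_iff frequently_def)
  then have "eventually (\<lambda>w. pointwise_schwarzian (\<lambda>w. 1 / f w) w = pointwise_schwarzian f w) (at z)"
  proof cases
    \<comment> \<open>Here \<open>1 / f\<close> coincides with \<open>f\<close>, since \<open>1 / 0 = 0\<close>.\<close>
    case 1
    then obtain S where S: "open S" "z \<in> S" "\<And>w. w \<in> S - {z} \<Longrightarrow> f w = 0"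
      by (auto simp: eventually_at_topological)
    have "pointwise_schwarzian (\<lambda>w. 1 / f w) w = pointwise_schwarzian f w"
      if w: "w \<in> S - {z}" for w
    proof (rule pointwise_schwarzian_cong)
      have "eventually (\<lambda>u. u \<in> S - {z}) (nhds w)"
        using S(1) w by (intro eventually_nhds_in_open) auto
      then show "eventually (\<lambda>u. 1 / f u = f u) (nhds w)"
        by eventually_elim (simp add: S(3))
    qed
    then show ?thesis
      using S(1,2) by (auto simp: eventually_at_topological)
  next
    case 2
    \<comment> \<open>A possible pole at \<open>z\<close> lies outside the punctured ball, so the
      pointwise lemma applies at every nearby \<open>w\<close>.\<close>
    obtain r where r: "r > 0" "f analytic_on ball z r - {z}"
      using mero by (auto simp: meromorphic_at_iff isolated_singularity_at_def)
    have "eventually (\<lambda>w. w \<in> ball z r - {z}) (at z)"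
      using r(1) by (intro eventually_at_in_open) auto
    then have "eventually (\<lambda>w. f analytic_on {w}) (at z)"
      by eventually_elim (auto intro: analytic_on_subset [OF r(2)])
    with 2 show ?thesis
      by eventually_elim (rule pointwise_schwarzian_reciprocal)
  qed
  then show "remove_sings (pointwise_schwarzian (\<lambda>w. 1 / f w)) z
      = remove_sings (pointwise_schwarzian f) z"
    by (rule remove_sings_cong) simp
qed

text \<open>Since \<open>f\<close> is 0 at its poles and \<open>1 / 0 = 0\<close>, the total
  function \<open>1 / f\<close> is again the canonical representative of the reciprocal.\<close>

theorem theorem2p4:
  fixes f :: "complex \<Rightarrow> complex"
  assumes "f nicely_meromorphic_on UNIV"
    and "\<not> f constant_on UNIV"
    and "\<exists>w. \<forall>z. \<not> is_pole f z \<longrightarrow> f z \<noteq> w"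
  shows "schwarzian f = schwarzian (\<lambda>z. 1 / f z)"
  using assms(1) by (simp add: schwarzian_reciprocal nicely_meromorphic_on_def)

end
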